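(* Let $t\leq 3$ be a positive integer. Then, for any positive integer $n$, the cyclic group $\mathbb{Z}_n$ is $t$-weak sequenceable; that is, every subset $A\subseteq\mathbb{Z}_n\setminus\{0\}$ with $|A|>t$ is $t$-weak sequenceable.
   Context: Let $G$ be an abelian group, $t$ a positive integer, and $A\subseteq G\setminus\{0\}$ a finite subset with $k=|A|>t$. For an ordering $(a_1,\ldots,a_k)$ of the elements of $A$ (each element listed exactly once), the partial sums are $s_0=0$ and $s_i=a_1+\cdots+a_i$ for $1\leq i\leq k$. The ordering is a $t$-weak sequencing of $A$ if $s_i\neq s_j$ for all $i,j\in\{0,1,\ldots,k\}$ with $i\neq j$ and $|i-j|\leq t$. The set $A$ is $t$-weak sequenceable if it admits a $t$-weak sequencing. The group $G$ is $t$-weak sequenceable if every subset of $G\setminus\{0\}$ of size bigger than $t$ is $t$-weak sequenceable. *)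

theory Defs
  imports "HOL-Algebra.Algebra"
begin

text \<open>The group operation is written multiplicatively, following HOL-Algebra; the
  definitions are meant for abelian groups, so that the partial sums \<open>a\<^sub>1 + \<dots> + a\<^sub>i\<close>
  are the finite products of the library. The ordering \<open>(a\<^sub>1, \<dots>, a\<^sub>k)\<close> is the list \<open>as\<close>
  with \<open>a\<^sub>i = as ! (i - 1)\<close>.\<close>

definition partial_sum :: "('a, 'b) monoid_scheme \<Rightarrow> 'a list \<Rightarrow> nat \<Rightarrow> 'a" where
  "partial_sum G as i = finprod G (\<lambda>j. as ! j) {..<i}"

definition weak_sequencing :: "('a, 'b) monoid_scheme \<Rightarrow> nat \<Rightarrow> 'a set \<Rightarrow> 'a list \<Rightarrow> bool" where
  "weak_sequencing G t A as \<longleftrightarrow>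
     distinct as \<and> set as = A \<and>
     (\<forall>i\<in>{0..length as}. \<forall>j\<in>{0..length as}.
        i \<noteq> j \<and> \<bar>int i - int j\<bar> \<le> int t \<longrightarrow> partial_sum G as i \<noteq> partial_sum G as j)"

definition weak_sequenceable :: "('a, 'b) monoid_scheme \<Rightarrow> nat \<Rightarrow> 'a set \<Rightarrow> bool" where
  "weak_sequenceable G t A \<longleftrightarrow> (\<exists>as. weak_sequencing G t A as)"

definition weak_sequenceable_group :: "('a, 'b) monoid_scheme \<Rightarrow> nat \<Rightarrow> bool" where
  "weak_sequenceable_group G t \<longleftrightarrow>
     (\<forall>A. A \<subseteq> carrier G - {\<one>\<^bsub>G\<^esub>} \<and> finite A \<and> card A > t \<longrightarrow> weak_sequenceable G t A)"

end

theory Submission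
  imports Defs
begin

text \<open>The argument works in every abelian group: for \<open>t = 3\<close> one has to order \<open>A\<close> such that no two
  and no three consecutive elements have trivial product. Given the last two elements \<open>p, q\<close> chosen,
  at most two elements are forbidden as the next one, so only the end of a greedy choice is critical.
  Call a set independent if no two distinct elements are mutually inverse. Four independent elements
  can be appended to any \<open>p, q\<close>: one first reaches three of them with nontrivial product. If \<open>A\<close> has
  an independent subset of size four, then the greedy choice can keep this property until exactly
  four independent elements remain, by using up elements whose inverse is still available.
  Otherwise \<open>A\<close> meets at most three classes \<open>{x, x\<^sup>-\<^sup>1}\<close>, and an order can be written down.\<close>

section \<open>Lists whose short consecutive products are nontrivial\<close>

text \<open>The arguments \<open>p\<close>, \<open>q\<close> are the two elements placed just before
  the list, so a greedy choice extends an order from the front and passes on only this history. With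
  \<open>p = q = \<one>\<close> the history imposes nothing beyond the entries being nontrivial and
  the condition on consecutive products.\<close>

fun admissible_after :: "('a, 'b) monoid_scheme \<Rightarrow> 'a \<Rightarrow> 'a \<Rightarrow> 'a list \<Rightarrow> bool" where
  "admissible_after G p q [] \<longleftrightarrow> True"
| "admissible_after G p q (x # xs) \<longleftrightarrow>
     q \<otimes>\<^bsub>G\<^esub> x \<noteq> \<one>\<^bsub>G\<^esub> \<and> p \<otimes>\<^bsub>G\<^esub> q \<otimes>\<^bsub>G\<^esub> x \<noteq> \<one>\<^bsub>G\<^esub> \<and> admissible_after G q x xs"

lemma admissible_after_consecutive:
  assumes "admissible_after G p q as" and "Suc i < length as"
  shows "as ! i \<otimes>\<^bsub>G\<^esub> as ! Suc i \<noteq> \<one>\<^bsub>G\<^esub>"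
  using assms
proof (induction G p q as arbitrary: i rule: admissible_after.induct)
  case (2 G p q x xs)
  then show ?case by (cases i; cases xs) auto
qed simp

lemma admissible_after_consecutive3:
  assumes "admissible_after G p q as" and "Suc (Suc i) < length as"
  shows "as ! i \<otimes>\<^bsub>G\<^esub> as ! Suc i \<otimes>\<^bsub>G\<^esub> as ! Suc (Suc i) \<noteq> \<one>\<^bsub>G\<^esub>"
  using assms
proof (induction G p q as arbitrary: i rule: admissible_after.induct)
  case (2 G p q x xs)
  show ?case
  proof (cases i)
    case 0
    with 2 obtain y z zs where "xs = y # z # zs"
      by (metis Suc_le_length_iff Suc_lessE length_Cons less_imp_Suc_add old.nat.inject order_refl Suc_length_conv)
    with 0 2 show ?thesis by simp
  next
    case (Suc j)
    with 2 show ?thesis by simp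
  qed
qed simp

context comm_group
begin

section \<open>Partial sums and weak sequencings\<close>

text \<open>Cancellation in the form used throughout: of two distinct elements, at most one
  completes a given product to \<open>\<one>\<close>. Hence whenever two continuations differ in a
  single element, one of them is harmless.\<close>

lemma eq_if_mult_one:
  assumes "x \<otimes> y = \<one>" "x \<otimes> z = \<one>" "x \<in> carrier G" "y \<in> carrier G" "z \<in> carrier G"
  shows "y = z"
  using assms by (metis l_cancel)

lemma partial_sum_Suc:
  assumes "set as \<subseteq> carrier G" and "i < length as"
  shows "partial_sum G as (Suc i) = partial_sum G as i \<otimes> as ! i"
proof -
  have "as ! j \<in> carrier G" if "j \<le> i" for j
    using assms that by (meson le_less_trans nth_mem subsetD)
  then show ?thesis
    unfolding partial_sum_def lessThan_Suc by (subst finprod_insert) (auto simp: m_comm)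
qed

lemma partial_sum_closed:
  assumes "set as \<subseteq> carrier G" and "i \<le> length as"
  shows "partial_sum G as i \<in> carrier G"
  unfolding partial_sum_def using assms by (intro finprod_closed) auto

lemma weak_sequencing_iff:
  "weak_sequencing G t A as \<longleftrightarrow> distinct as \<and> set as = A \<and>
    (\<forall>i j. i < j \<and> j \<le> length as \<and> j \<le> i + t \<longrightarrow> partial_sum G as i \<noteq> partial_sum G as j)"
    (is "_ \<longleftrightarrow> _ \<and> _ \<and> ?P")
proof -
  have "(\<forall>i\<in>{0..length as}. \<forall>j\<in>{0..length as}. i \<noteq> j \<and> \<bar>int i - int j\<bar> \<le> int t \<longrightarrow>
      partial_sum G as i \<noteq> partial_sum G as j) \<longleftrightarrow> ?P" (is "?Q \<longleftrightarrow> _")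
  proof
    assume ?Q
    then show ?P by auto
  next
    assume P: ?P
    show ?Q
    proof (intro ballI impI)
      fix i j assume *: "i \<in> {0..length as}" "j \<in> {0..length as}" "i \<noteq> j \<and> \<bar>int i - int j\<bar> \<le> int t"
      then consider "i < j" "j \<le> i + t" | "j < i" "i \<le> j + t" by linarith
      then show "partial_sum G as i \<noteq> partial_sum G as j"
        using P * by cases (auto, metis)
    qed
  qed
  then show ?thesis unfolding weak_sequencing_def by simp
qed

text \<open>Two partial sums at distance \<open>d\<close> differ by the product of \<open>d\<close>
  consecutive entries, so they coincide only if that product is trivial. Distance 1 is covered by
  \<open>\<one>\<close> not lying in \<open>A\<close>; the guards on \<open>t\<close> make the other
  conditions vacuous for small \<open>t\<close>.\<close>

lemma weak_sequencingI:
  assumes "distinct as" "set as = A" "A \<subseteq> carrier G - {\<one>}" "t \<le> 3"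
    and two: "\<And>i. 2 \<le> t \<Longrightarrow> Suc i < length as \<Longrightarrow> as ! i \<otimes> as ! Suc i \<noteq> \<one>"
    and three: "\<And>i. 3 \<le> t \<Longrightarrow> Suc (Suc i) < length as \<Longrightarrow>
      as ! i \<otimes> as ! Suc i \<otimes> as ! Suc (Suc i) \<noteq> \<one>"
  shows "weak_sequencing G t A as"
proof -
  have sub: "set as \<subseteq> carrier G" using assms by auto
  have nth: "as ! i \<in> carrier G \<and> as ! i \<noteq> \<one>" if "i < length as" for i
    using assms(2,3) nth_mem[OF that] by auto
  note S = partial_sum_Suc[OF sub] partial_sum_closed[OF sub]
  have "partial_sum G as i \<noteq> partial_sum G as j" if "i < j" "j \<le> length as" "j \<le> i + t" for i j
  proof -
    have "j = Suc i \<or> j = Suc (Suc i) \<and> 2 \<le> t \<or> j = Suc (Suc (Suc i)) \<and> 3 \<le> t"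
      using that assms(4) by linarith
    moreover have False if "x = x \<otimes> y" "y \<noteq> \<one>" "x \<in> carrier G" "y \<in> carrier G" for x y
      using that by simp
    ultimately show ?thesis
      using that(2) S nth two[of i] three[of i] by (auto simp: m_assoc)
  qed
  then show ?thesis using assms(1,2) by (simp add: weak_sequencing_iff)
qed

section \<open>Greedy choice with independent sets\<close>

lemma ex_allowed:
  assumes "S \<subseteq> carrier G" "3 \<le> card S" "p \<in> carrier G" "q \<in> carrier G"
  obtains x where "x \<in> S" "q \<otimes> x \<noteq> \<one>" "p \<otimes> q \<otimes> x \<noteq> \<one>"
proof -
  have "card {inv q, inv (p \<otimes> q)} \<le> 2" by (simp add: card_insert_if)
  then have "\<not> S \<subseteq> {inv q, inv (p \<otimes> q)}"
    using assms(2) card_mono[of "{inv q, inv (p \<otimes> q)}" S] by auto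
  then obtain x where x: "x \<in> S" "x \<noteq> inv q" "x \<noteq> inv (p \<otimes> q)" by auto
  moreover have "inv y = x" if "y \<otimes> x = \<one>" "y \<in> carrier G" for y
    using that x assms(1) by (metis inv_equality inv_inv subsetD m_comm)
  ultimately show thesis using that assms by (metis m_closed)
qed

text \<open>Some element is allowed first. Independence settles all adjacent products inside the
  triple and \<open>prod\<close> settles the triple itself in every order, so only the product of
  \<open>q\<close> with the first two entries remains; it can be trivial for at most one order of
  the last two.\<close>

lemma admissible_independent3:
  assumes indep: "pairwise (\<lambda>x y. x \<otimes> y \<noteq> \<one>) {u, v, w}" and dist: "distinct [u, v, w]"
    and prod: "u \<otimes> v \<otimes> w \<noteq> \<one>"
    and carr: "{u, v, w} \<subseteq> carrier G" "p \<in> carrier G" "q \<in> carrier G"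
  shows "\<exists>as. distinct as \<and> set as = {u, v, w} \<and> admissible_after G p q as"
proof -
  have first: "\<exists>as. distinct as \<and> set as = {x, y, z} \<and> admissible_after G p q as"
    if props: "pairwise (\<lambda>x y. x \<otimes> y \<noteq> \<one>) {x, y, z}" "distinct [x, y, z]" "x \<otimes> y \<otimes> z \<noteq> \<one>"
      "{x, y, z} \<subseteq> carrier G" "q \<otimes> x \<noteq> \<one>" "p \<otimes> q \<otimes> x \<noteq> \<one>" for x y z
  proof -
    have "q \<otimes> x \<otimes> y \<noteq> \<one> \<or> q \<otimes> x \<otimes> z \<noteq> \<one>"
      using eq_if_mult_one[of "q \<otimes> x" y z] props carr by auto
    moreover have "x \<otimes> z \<otimes> y \<noteq> \<one>"
      using props by (simp add: m_ac)
    moreover have "x \<otimes> y \<noteq> \<one>" "x \<otimes> z \<noteq> \<one>" "y \<otimes> z \<noteq> \<one>" "z \<otimes> y \<noteq> \<one>"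
      using props by (auto simp: pairwise_def)
    ultimately consider "admissible_after G p q [x, y, z]" | "admissible_after G p q [x, z, y]"
      using props by auto
    then show ?thesis
    proof cases
      case 1
      with props(2) show ?thesis by (intro exI[of _ "[x, y, z]"]) auto
    next
      case 2
      with props(2) show ?thesis by (intro exI[of _ "[x, z, y]"]) auto
    qed
  qed
  obtain x where x: "x \<in> {u, v, w}" "q \<otimes> x \<noteq> \<one>" "p \<otimes> q \<otimes> x \<noteq> \<one>"
    using ex_allowed[of "{u, v, w}" p q] assms by auto
  have perm: "{v, u, w} = {u, v, w}" "{w, u, v} = {u, v, w}"
    "v \<otimes> u \<otimes> w = u \<otimes> v \<otimes> w" "w \<otimes> u \<otimes> v = u \<otimes> v \<otimes> w"
    using carr by (auto simp: m_ac)
  from x(1) consider "x = u" | "x = v" | "x = w" by blast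
  then show ?thesis
  proof cases
    case 1
    then show ?thesis using first[of u v w] assms x by simp
  next
    case 2
    then show ?thesis using first[of v u w] assms x perm by auto
  next
    case 3
    then show ?thesis using first[of w u v] assms x perm by auto
  qed
qed

lemma admissible_Cons:
  assumes "\<exists>as. distinct as \<and> set as = A - {x} \<and> admissible_after G q x as" "x \<in> A"
    and "q \<otimes> x \<noteq> \<one>" "p \<otimes> q \<otimes> x \<noteq> \<one>"
  shows "\<exists>as. distinct as \<and> set as = A \<and> admissible_after G p q as"
proof -
  obtain as where "distinct as" "set as = A - {x}" "admissible_after G q x as"
    using assms(1) by blast
  with assms show ?thesis by (intro exI[of _ "x # as"]) auto
qed

text \<open>Among four elements at least two, \<open>x\<close> and \<open>y\<close>, are allowed
  first. The triples left after removing one or the other differ only in \<open>x\<close> against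
  \<open>y\<close>, so at most one has trivial product, and the other choice leaves a triple with
  nontrivial product.\<close>

lemma admissible_independent4:
  assumes indep: "pairwise (\<lambda>x y. x \<otimes> y \<noteq> \<one>) A" and card: "card A = 4"
    and carr: "A \<subseteq> carrier G" "p \<in> carrier G" "q \<in> carrier G"
  shows "\<exists>as. distinct as \<and> set as = A \<and> admissible_after G p q as"
proof -
  obtain x where x: "x \<in> A" "q \<otimes> x \<noteq> \<one>" "p \<otimes> q \<otimes> x \<noteq> \<one>"
    using ex_allowed[of A p q] assms by auto
  obtain y where y: "y \<in> A - {x}" "q \<otimes> y \<noteq> \<one>" "p \<otimes> q \<otimes> y \<noteq> \<one>"
    using ex_allowed[of "A - {x}" p q] assms x by auto
  have "card (A - {x} - {y}) = 2" using card x y by simp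
  then obtain u v where uv: "A - {x} - {y} = {u, v}" "u \<noteq> v" by (auto simp: card_2_iff)
  have A: "A - {x} = {y, u, v}" "A - {y} = {x, u, v}" "distinct [x, y, u, v]"
    using uv x y by auto
  have in_carr: "x \<in> carrier G" "y \<in> carrier G" "u \<in> carrier G" "v \<in> carrier G"
    using A carr x y by auto
  have pw: "pairwise (\<lambda>x y. x \<otimes> y \<noteq> \<one>) (A - {z})" for z
    using indep by (rule pairwise_subset) auto
  have "x \<otimes> u \<otimes> v \<noteq> \<one> \<or> y \<otimes> u \<otimes> v \<noteq> \<one>"
    using eq_if_mult_one[of "u \<otimes> v" x y] in_carr y by (auto simp: m_ac)
  then show ?thesis
  proof
    assume "x \<otimes> u \<otimes> v \<noteq> \<one>"
    then have "\<exists>as. distinct as \<and> set as = A - {y} \<and> admissible_after G q y as"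
      using admissible_independent3[of x u v q y] pw[of y] A in_carr carr by simp
    then show ?thesis using admissible_Cons y by blast
  next
    assume "y \<otimes> u \<otimes> v \<noteq> \<one>"
    then have "\<exists>as. distinct as \<and> set as = A - {x} \<and> admissible_after G q x as"
      using admissible_independent3[of y u v q x] pw[of x] A in_carr carr by simp
    then show ?thesis using admissible_Cons x by blast
  qed
qed

lemma admissible_if_independent4:
  assumes "finite A" "A \<subseteq> carrier G" "p \<in> carrier G" "q \<in> carrier G" "q \<notin> A"
    and "B \<subseteq> A" "pairwise (\<lambda>x y. x \<otimes> y \<noteq> \<one>) B" "4 \<le> card B"
  shows "\<exists>as. distinct as \<and> set as = A \<and> admissible_after G p q as"
  using assms
proof (induction "card A" arbitrary: A B p q rule: less_induct)
  case less
  have step: "\<exists>as. distinct as \<and> set as = A \<and> admissible_after G p q as"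
    if "x \<in> A" "q \<otimes> x \<noteq> \<one>" "p \<otimes> q \<otimes> x \<noteq> \<one>" "C \<subseteq> A - {x}"
      "pairwise (\<lambda>x y. x \<otimes> y \<noteq> \<one>) C" "4 \<le> card C" for x C
  proof -
    have "card (A - {x}) < card A" using less.prems(1) that(1) by (meson card_Diff1_less)
    then have "\<exists>as. distinct as \<and> set as = A - {x} \<and> admissible_after G q x as"
      using less.hyps[of "A - {x}" q x C] less.prems that by blast
    then show ?thesis using admissible_Cons that by blast
  qed
  show ?case
  proof (cases "pairwise (\<lambda>x y. x \<otimes> y \<noteq> \<one>) A")
    case True
    have "card B \<le> card A" using less.prems by (intro card_mono)
    then consider "card A = 4" | "5 \<le> card A" using less.prems(8) by linarith
    then show ?thesis
    proof cases
      case 1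
      then show ?thesis using admissible_independent4 True less.prems by blast
    next
      case 2
      then obtain x where "x \<in> A" "q \<otimes> x \<noteq> \<one>" "p \<otimes> q \<otimes> x \<noteq> \<one>"
        using ex_allowed[of A p q] less.prems 2 by auto
      \<comment> \<open>With at least five elements, all independent, any allowed element may be
        spent: the remainder is itself an independent set of size at least four.\<close>
      moreover have "pairwise (\<lambda>x y. x \<otimes> y \<noteq> \<one>) (A - {x})"
        using True by (rule pairwise_subset) auto
      ultimately show ?thesis using step[of x "A - {x}"] 2 less.prems(1) by simp
    qed
  next
    case False
    \<comment> \<open>Removing one of two mutually inverse elements does not decrease the number of classes
      \<open>{x, inv x}\<close> met by the set, and the other one replaces it in the independent subset.\<close>
    have pair: "\<exists>as. distinct as \<and> set as = A \<and> admissible_after G p q as"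
      if xy: "x \<in> A" "y \<in> A" "x \<noteq> y" "x \<otimes> y = \<one>" "p \<otimes> q \<otimes> x \<noteq> \<one>" for x y
    proof -
      have in_carr: "x \<in> carrier G" "y \<in> carrier G" using xy less.prems by auto
      \<comment> \<open>The inverse of \<open>x\<close> is \<open>y\<close>, which is still in
        \<open>A\<close>, whereas \<open>q\<close> has already been used.\<close>
      have "q \<otimes> x \<noteq> \<one>"
        using eq_if_mult_one[of x q y] less.prems xy in_carr by (auto simp: m_comm)
      moreover have "\<exists>C \<subseteq> A - {x}. pairwise (\<lambda>x y. x \<otimes> y \<noteq> \<one>) C \<and> 4 \<le> card C"
      proof (cases "x \<in> B")
        case x: True
        have "y \<otimes> z \<noteq> \<one>" "z \<otimes> y \<noteq> \<one>" if "z \<in> B - {x}" for z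
          using that eq_if_mult_one[of y z x] xy in_carr less.prems by (auto simp: m_comm subset_iff)
        then have "pairwise (\<lambda>x y. x \<otimes> y \<noteq> \<one>) (insert y (B - {x}))"
          using less.prems(7) by (auto simp: pairwise_insert intro: pairwise_subset)
        moreover have "y \<notin> B" using x xy less.prems(7) by (auto simp: pairwise_def)
        moreover have "finite B" using less.prems finite_subset by blast
        ultimately show ?thesis using x xy less.prems
          by (intro exI[of _ "insert y (B - {x})"]) (auto simp: card.insert_remove)
      qed (use less.prems in blast)
      ultimately show ?thesis using step xy by blast
    qed
    obtain x y where xy: "x \<in> A" "y \<in> A" "x \<noteq> y" "x \<otimes> y = \<one>"
      using False by (auto simp: pairwise_def)
    have in_carr: "x \<in> carrier G" "y \<in> carrier G" using xy less.prems by auto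
    \<comment> \<open>The only remaining obstruction is the product with \<open>p\<close> and
      \<open>q\<close>, and it cannot exclude both members of the pair.\<close>
    have "p \<otimes> q \<otimes> x \<noteq> \<one> \<or> p \<otimes> q \<otimes> y \<noteq> \<one>"
      using eq_if_mult_one[of "p \<otimes> q" x y] less.prems xy in_carr by auto
    then show ?thesis using pair[of x y] pair[of y x] xy in_carr by (auto simp: m_comm)
  qed
qed

section \<open>Explicit orders for few inverse pairs\<close>

text \<open>Multiplying the two relations cancels the pairs \<open>x, x'\<close> and
  \<open>y, y'\<close> and leaves \<open>z z = \<one>\<close>, so \<open>z\<close> is its own
  inverse.\<close>

lemma eq_if_mult3_one:
  assumes "x \<otimes> y \<otimes> z = \<one>" "x' \<otimes> y' \<otimes> z = \<one>" "x \<otimes> x' = \<one>" "y \<otimes> y' = \<one>" "z \<otimes> z' = \<one>"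
    and carr: "{x, x', y, y', z, z'} \<subseteq> carrier G"
  shows "z = z'"
proof -
  have "z \<otimes> z = (x \<otimes> x') \<otimes> (y \<otimes> y') \<otimes> (z \<otimes> z)" using assms by simp
  also have "\<dots> = (x \<otimes> y \<otimes> z) \<otimes> (x' \<otimes> y' \<otimes> z)" using carr by (simp add: m_ac)
  finally have "z \<otimes> z = \<one>" using assms by simp
  then show ?thesis using eq_if_mult_one[of z z z'] assms by simp
qed

text \<open>In the interleaved orders below, a triple containing an inverse pair collapses to its
  third element, which is nontrivial.\<close>

lemma mult_inverse_pair:
  assumes "x \<otimes> x' = \<one>" "{x, x', y} \<subseteq> carrier G"
  shows "x \<otimes> y \<otimes> x' = y" "y \<otimes> x \<otimes> x' = y" "x \<otimes> x' \<otimes> y = y" "x' \<otimes> x = \<one>"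
proof -
  show "x' \<otimes> x = \<one>" using assms by (simp add: m_comm)
  show "x \<otimes> y \<otimes> x' = y" using assms by (metis insert_subset l_one m_assoc m_comm)
  show "y \<otimes> x \<otimes> x' = y" using assms by (simp add: m_assoc)
  show "x \<otimes> x' \<otimes> y = y" using assms by simp
qed

lemma admissible_2_pairs:
  assumes "a \<otimes> a' = \<one>" "b \<otimes> b' = \<one>" "distinct [a, a', b, b']" "{a, a', b, b'} \<subseteq> carrier G - {\<one>}"
  shows "admissible_after G \<one> \<one> [a, b, a', b']"
proof -
  have "a \<otimes> b \<noteq> \<one>" "b \<otimes> a' \<noteq> \<one>" "a' \<otimes> b' \<noteq> \<one>"
    using assms eq_if_mult_one[of a b a'] eq_if_mult_one[of b a' b'] eq_if_mult_one[of b' a' b]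
    by (auto simp: m_comm)
  then show ?thesis using assms by (simp add: mult_inverse_pair)
qed

text \<open>Separating \<open>a\<close> and \<open>a'\<close> by \<open>c\<close> collapses the
  first triple to \<open>c\<close>. Only the last triple is in doubt, and exchanging
  \<open>a\<close> with \<open>a'\<close> alters it in one factor.\<close>

lemma admissible_pair_2:
  assumes "a \<otimes> a' = \<one>" "distinct [a, a', c, d]" "{a, a', c, d} \<subseteq> carrier G - {\<one>}"
  shows "admissible_after G \<one> \<one> [a, c, a', d] \<or> admissible_after G \<one> \<one> [a', c, a, d]"
proof -
  have "a \<otimes> c \<noteq> \<one>" "a' \<otimes> c \<noteq> \<one>" "c \<otimes> a' \<noteq> \<one>" "c \<otimes> a \<noteq> \<one>" "a \<otimes> d \<noteq> \<one>" "a' \<otimes> d \<noteq> \<one>"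
    using assms eq_if_mult_one[of a a' c] eq_if_mult_one[of a' a c]
      eq_if_mult_one[of a a' d] eq_if_mult_one[of a' a d]
    by (auto simp: m_comm)
  moreover have "c \<otimes> a' \<otimes> d \<noteq> \<one> \<or> c \<otimes> a \<otimes> d \<noteq> \<one>"
    using assms eq_if_mult_one[of "c \<otimes> d" a a'] by (auto simp: m_ac)
  ultimately show ?thesis using assms by (auto simp: mult_inverse_pair)
qed

text \<open>Appending \<open>c\<close> to an order of two pairs creates one doubtful triple, the
  last one; exchanging \<open>b\<close> with \<open>b'\<close> alters it in one factor.\<close>

lemma admissible_2_pairs_1:
  assumes "a \<otimes> a' = \<one>" "b \<otimes> b' = \<one>" "distinct [a, a', b, b', c]"
    and "{a, a', b, b', c} \<subseteq> carrier G - {\<one>}"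
  shows "admissible_after G \<one> \<one> [a, b, a', b', c] \<or> admissible_after G \<one> \<one> [a, b', a', b, c]"
proof -
  have "admissible_after G \<one> \<one> [a, b, a', b']" "admissible_after G \<one> \<one> [a, b', a', b]"
    using assms by (intro admissible_2_pairs; auto simp: m_comm)+
  moreover have "b \<otimes> c \<noteq> \<one>" "b' \<otimes> c \<noteq> \<one>"
    using assms eq_if_mult_one[of b b' c] eq_if_mult_one[of b' b c] by (auto simp: m_comm)
  moreover have "a' \<otimes> b' \<otimes> c \<noteq> \<one> \<or> a' \<otimes> b \<otimes> c \<noteq> \<one>"
    using assms eq_if_mult_one[of "a' \<otimes> c" b b'] by (auto simp: m_ac)
  ultimately show ?thesis using assms by auto
qed

text \<open>The order has four triples, but \<open>a' b' c'\<close> is inverse to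
  \<open>a b c\<close>, and \<open>c a' b'\<close> is inverse to \<open>a b c'\<close>. This leaves
  the three conditions assumed.\<close>

lemma admissible_3_pairs_aux:
  assumes "a \<otimes> a' = \<one>" "b \<otimes> b' = \<one>" "c \<otimes> c' = \<one>"
    and "distinct [a, a', b, b', c, c']" "{a, a', b, b', c, c'} \<subseteq> carrier G - {\<one>}"
    and "a \<otimes> b \<otimes> c \<noteq> \<one>" "a' \<otimes> b \<otimes> c \<noteq> \<one>" "a \<otimes> b \<otimes> c' \<noteq> \<one>"
  shows "admissible_after G \<one> \<one> [a, b, c, a', b', c']"
proof -
  have neq: "x \<otimes> y \<noteq> \<one>" if "x \<otimes> x' = \<one>" "y \<noteq> x'" "{x, x', y} \<subseteq> carrier G" for x x' y
    using that eq_if_mult_one[of x x' y] by auto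
  have inverse: "x' \<otimes> y' \<otimes> z' \<noteq> \<one>"
    if "x \<otimes> x' = \<one>" "y \<otimes> y' = \<one>" "z \<otimes> z' = \<one>" "x \<otimes> y \<otimes> z \<noteq> \<one>"
      "{x, x', y, y', z, z'} \<subseteq> carrier G" for x x' y y' z z'
  proof
    assume "x' \<otimes> y' \<otimes> z' = \<one>"
    then have "x \<otimes> y \<otimes> z = (x \<otimes> y \<otimes> z) \<otimes> (x' \<otimes> y' \<otimes> z')" using that by simp
    also have "\<dots> = (x \<otimes> x') \<otimes> (y \<otimes> y') \<otimes> (z \<otimes> z')" using that by (simp add: m_ac)
    finally show False using that by simp
  qed
  have "a \<otimes> b \<noteq> \<one>" "b \<otimes> c \<noteq> \<one>" "c \<otimes> a' \<noteq> \<one>" "a' \<otimes> b' \<noteq> \<one>" "b' \<otimes> c' \<noteq> \<one>"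
    using assms neq[of a a' b] neq[of b b' c] neq[of c c' a'] neq[of a' a b'] neq[of b' b c']
    by (auto simp: m_comm)
  moreover have "a' \<otimes> b' \<otimes> c' \<noteq> \<one>" "c \<otimes> a' \<otimes> b' \<noteq> \<one>"
    using assms inverse[of a a' b b' c c'] inverse[of c' c a a' b b'] by (auto simp: m_ac)
  moreover have "b \<otimes> c \<otimes> a' \<noteq> \<one>" using assms by (auto simp: m_ac)
  ultimately show ?thesis using assms by auto
qed

lemma admissible_3_pairs:
  assumes pairs: "a \<otimes> a' = \<one>" "b \<otimes> b' = \<one>" "c \<otimes> c' = \<one>"
    and dist: "distinct [a, a', b, b', c, c']" and sub: "{a, a', b, b', c, c'} \<subseteq> carrier G - {\<one>}"
  shows "\<exists>as. distinct as \<and> set as = {a, a', b, b', c, c'} \<and> admissible_after G \<one> \<one> as"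
proof -
  \<comment> \<open>Two of the products \<open>a\<^sup>\<plusminus>b\<^sup>\<plusminus>c\<^sup>\<plusminus>\<close> that are not inverse to each other cannot both be trivial,
    and the order \<open>x, y, z, x', y', z'\<close> tolerates \<open>x y' z = \<one>\<close>.\<close>
  have middle: "admissible_after G \<one> \<one> [x, y, z, x', y', z']"
    if "x \<otimes> x' = \<one>" "y \<otimes> y' = \<one>" "z \<otimes> z' = \<one>" "distinct [x, x', y, y', z, z']"
      "{x, x', y, y', z, z'} \<subseteq> carrier G - {\<one>}" "x \<otimes> y' \<otimes> z = \<one>" for x x' y y' z z'
  proof (rule admissible_3_pairs_aux)
    \<comment> \<open>Compared with \<open>x y' z\<close>, this triple changes one factor, so
      cancellation suffices. The next two change two factors; the factor they share would have to be
      its own inverse.\<close>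
    show "x \<otimes> y \<otimes> z \<noteq> \<one>"
      using that eq_if_mult_one[of "x \<otimes> z" y y'] by (auto simp: m_ac)
    show "x' \<otimes> y \<otimes> z \<noteq> \<one>"
      using that eq_if_mult3_one[of x y' z x' y z'] by (auto simp: m_comm)
    show "x \<otimes> y \<otimes> z' \<noteq> \<one>"
      using that eq_if_mult3_one[of y' z x y z' x'] by (auto simp: m_ac)
  qed (use that in auto)
  \<comment> \<open>A trivial triple among the first three is brought to the tolerated position
    \<open>x y' z\<close> by renaming. Otherwise the given order works, whatever
    \<open>a b' c\<close> is.\<close>
  consider "a \<otimes> b \<otimes> c = \<one>" | "a' \<otimes> b \<otimes> c = \<one>" | "a \<otimes> b \<otimes> c' = \<one>"
    | "a \<otimes> b \<otimes> c \<noteq> \<one>" "a' \<otimes> b \<otimes> c \<noteq> \<one>" "a \<otimes> b \<otimes> c' \<noteq> \<one>" by blast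
  then show ?thesis
  proof cases
    case 1
    then have "admissible_after G \<one> \<one> [a, b', c, a', b, c']"
      using assms by (intro middle) (auto simp: m_comm)
    then show ?thesis using dist by (intro exI[of _ "[a, b', c, a', b, c']"]) auto
  next
    case 2
    then have "admissible_after G \<one> \<one> [b, a, c, b', a', c']"
      using assms by (intro middle) (auto simp: m_ac)
    then show ?thesis using dist by (intro exI[of _ "[b, a, c, b', a', c']"]) auto
  next
    case 3
    then have "admissible_after G \<one> \<one> [a, c, b, a', c', b']"
      using assms by (intro middle) (auto simp: m_ac)
    then show ?thesis using dist by (intro exI[of _ "[a, c, b, a', c', b']"]) auto
  next
    case 4
    then have "admissible_after G \<one> \<one> [a, b, c, a', b', c']"
      using assms by (intro admissible_3_pairs_aux)
    then show ?thesis using dist by (intro exI[of _ "[a, b, c, a', b', c']"]) auto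
  qed
qed

section \<open>Sets of at least four elements\<close>

lemma ex_admissible:
  assumes "finite A" "A \<subseteq> carrier G - {\<one>}" "4 \<le> card A"
  shows "\<exists>as. distinct as \<and> set as = A \<and> admissible_after G \<one> \<one> as"
proof (cases "\<exists>B \<subseteq> A. pairwise (\<lambda>x y. x \<otimes> y \<noteq> \<one>) B \<and> 4 \<le> card B")
  case True
  then show ?thesis using admissible_if_independent4[of A \<one> \<one>] assms by blast
next
  case False
  have no_indep: "card B \<le> 3" if "B \<subseteq> A" "pairwise (\<lambda>x y. x \<otimes> y \<noteq> \<one>) B" for B
    using False that by (metis not_less_eq_eq eval_nat_numeral(2) semiring_norm(26,27))
  have carr: "x \<in> carrier G" if "x \<in> A" for x using assms that by auto
  have neq: "x \<otimes> y \<noteq> \<one> \<and> y \<otimes> x \<noteq> \<one>"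
    if "x \<otimes> x' = \<one>" "x \<in> A" "x' \<in> A" "y \<in> A" "y \<noteq> x'" for x x' y
    using that carr eq_if_mult_one[of x x' y] m_comm[of x y] by auto
  \<comment> \<open>One member of an inverse pair can join any independent set that avoids its
    partner. Splitting off pairs thus bounds what remains: each pair uses up one of the three
    independent elements available.\<close>
  have indep_insert: "pairwise (\<lambda>x y. x \<otimes> y \<noteq> \<one>) (insert x B)"
    if "x \<otimes> x' = \<one>" "x \<in> A" "x' \<in> A" "B \<subseteq> A - {x'}" "pairwise (\<lambda>x y. x \<otimes> y \<noteq> \<one>) B" for x x' B
    using that neq[of x x'] by (auto simp: pairwise_insert)
  have "\<not> pairwise (\<lambda>x y. x \<otimes> y \<noteq> \<one>) A" using no_indep[of A] assms by auto
  then obtain a a' where a: "a \<in> A" "a' \<in> A" "a \<noteq> a'" "a \<otimes> a' = \<one>"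
    by (auto simp: pairwise_def)
  define A1 where "A1 = A - {a, a'}"
  have card1: "card A = card A1 + 2" "finite A1"
    using a assms unfolding A1_def by (auto simp: card_Diff_subset)
  show ?thesis
  proof (cases "pairwise (\<lambda>x y. x \<otimes> y \<noteq> \<one>) A1")
    case True
    \<comment> \<open>One pair is split off and the rest is independent: at most two elements
      remain, and at least two by the size of \<open>A\<close>.\<close>
    then have "card (insert a A1) \<le> 3"
      using a by (intro no_indep indep_insert[of a a']) (auto simp: A1_def)
    then have "card A1 = 2" using card1 assms(3) by (simp add: A1_def)
    then obtain c d where cd: "A1 = {c, d}" "c \<noteq> d" by (auto simp: card_2_iff)
    then have A: "A = {a, a', c, d}" "distinct [a, a', c, d]" using a by (auto simp: A1_def)
    from admissible_pair_2[of a a' c d] a A assms(2)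
    consider "admissible_after G \<one> \<one> [a, c, a', d]"
      | "admissible_after G \<one> \<one> [a', c, a, d]" by blast
    then show ?thesis
    proof cases
      case 1
      then show ?thesis using A by (intro exI[of _ "[a, c, a', d]"]) auto
    next
      case 2
      then show ?thesis using A by (intro exI[of _ "[a', c, a, d]"]) auto
    qed
  next
    case False
    then obtain b b' where b: "b \<in> A1" "b' \<in> A1" "b \<noteq> b'" "b \<otimes> b' = \<one>"
      by (auto simp: pairwise_def)
    define A2 where "A2 = A1 - {b, b'}"
    have finite2: "finite A2" using card1 by (simp add: A2_def)
    have A: "A = {a, a', b, b'} \<union> A2" "distinct [a, a', b, b']" "A2 \<inter> {a, a', b, b'} = {}"
      using a b by (auto simp: A1_def A2_def)
    \<comment> \<open>With \<open>a\<close> and \<open>b\<close> added, \<open>B\<close> is still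
      independent, so two of the three places are taken.\<close>
    have le1: "card B \<le> 1" if "B \<subseteq> A2" "pairwise (\<lambda>x y. x \<otimes> y \<noteq> \<one>) B" for B
    proof -
      have "pairwise (\<lambda>x y. x \<otimes> y \<noteq> \<one>) (insert a (insert b B))"
        using a b A that by (intro indep_insert[of a a'] indep_insert[of b b']) auto
      then have "card (insert a (insert b B)) \<le> 3" using that A by (intro no_indep) auto
      moreover have "finite B" "a \<notin> insert b B" "b \<notin> B"
        using that A finite2 finite_subset by auto
      ultimately show ?thesis by simp
    qed
    show ?thesis
    proof (cases "pairwise (\<lambda>x y. x \<otimes> y \<noteq> \<one>) A2")
      case True
      then have "card A2 \<le> 1" using le1 by blast
      then consider "A2 = {}" | c where "A2 = {c}"
        using finite2 by (metis card_0_eq card_1_singletonE le_eq_less_or_eq less_one)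
      then show ?thesis
      proof cases
        case 1
        then show ?thesis using admissible_2_pairs[of a a' b b'] a b A assms(2)
          by (intro exI[of _ "[a, b, a', b']"]) auto
      next
        case 2
        then have A': "A = {a, a', b, b', c}" "distinct [a, a', b, b', c]" using A by auto
        from admissible_2_pairs_1[of a a' b b' c] a b A' assms(2)
        consider "admissible_after G \<one> \<one> [a, b, a', b', c]"
          | "admissible_after G \<one> \<one> [a, b', a', b, c]" by blast
        then show ?thesis
        proof cases
          case 1
          then show ?thesis using A' by (intro exI[of _ "[a, b, a', b', c]"]) auto
        next
          case 2
          then show ?thesis using A' by (intro exI[of _ "[a, b', a', b, c]"]) auto
        qed
      qed
    next
      case False
      then obtain c c' where c: "c \<in> A2" "c' \<in> A2" "c \<noteq> c'" "c \<otimes> c' = \<one>"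
        by (auto simp: pairwise_def)
      \<comment> \<open>A further element \<open>d\<close> would form with \<open>c\<close> an
        independent subset of \<open>A2\<close> of size two.\<close>
      have "A2 = {c, c'}"
      proof (rule ccontr)
        assume "A2 \<noteq> {c, c'}"
        then obtain d where d: "d \<in> A2" "d \<noteq> c" "d \<noteq> c'" using c by auto
        then have "card {c, d} \<le> 1"
          using c A by (intro le1 indep_insert[of c c']) (auto simp: pairwise_def)
        then show False using d by auto
      qed
      then have A': "A = {a, a', b, b', c, c'}" "distinct [a, a', b, b', c, c']"
        using A c(3) by auto
      then show ?thesis using admissible_3_pairs[of a a' b b' c c'] a b c assms(2) by blast
    qed
  qed
qed

section \<open>Three elements\<close>

text \<open>For \<open>t \<le> 2\<close> only adjacent products matter. If some two elements are
  mutually inverse, they go to the two ends, with the third element between them.\<close>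

lemma weak_sequenceable_card3:
  assumes sub: "A \<subseteq> carrier G - {\<one>}" and card: "card A = 3" and "t \<le> 2"
  shows "weak_sequenceable G t A"
proof -
  have "\<exists>x y z. A = {x, y, z} \<and> distinct [x, y, z] \<and> x \<otimes> y \<noteq> \<one> \<and> y \<otimes> z \<noteq> \<one>"
  proof (cases "pairwise (\<lambda>x y. x \<otimes> y \<noteq> \<one>) A")
    case True
    obtain x y z where A: "A = {x, y, z}" "distinct [x, y, z]"
      using card by (auto simp: card_3_iff)
    with True have "x \<otimes> y \<noteq> \<one>" "y \<otimes> z \<noteq> \<one>" by (auto simp: pairwise_def)
    with A show ?thesis by blast
  next
    case False
    then obtain x z where xz: "x \<in> A" "z \<in> A" "x \<noteq> z" "x \<otimes> z = \<one>"
      by (auto simp: pairwise_def)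
    have "finite A" using card card.infinite by fastforce
    then have "card (A - {x, z}) = 1" using card xz by (simp add: card_Diff_subset)
    then obtain y where y: "A - {x, z} = {y}" by (auto simp: card_1_singleton_iff)
    then have A: "A = {x, y, z}" "distinct [x, y, z]" using xz by auto
    have "x \<otimes> y \<noteq> \<one>" "y \<otimes> z \<noteq> \<one>"
      using A xz sub eq_if_mult_one[of x z y] eq_if_mult_one[of z x y] by (auto simp: m_comm)
    with A show ?thesis by blast
  qed
  then obtain x y z where *: "A = {x, y, z}" "distinct [x, y, z]" "x \<otimes> y \<noteq> \<one>" "y \<otimes> z \<noteq> \<one>"
    by blast
  have "weak_sequencing G t A [x, y, z]"
  proof (rule weak_sequencingI)
    fix i assume "Suc i < length [x, y, z]"
    then have "i = 0 \<or> i = 1" by auto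
    then show "[x, y, z] ! i \<otimes> [x, y, z] ! Suc i \<noteq> \<one>" using * by auto
  qed (use * sub \<open>t \<le> 2\<close> in simp_all)
  then show ?thesis unfolding weak_sequenceable_def by blast
qed

section \<open>Abelian groups and the cyclic case\<close>

theorem weak_sequenceable_group_le3:
  assumes "t \<le> 3"
  shows "weak_sequenceable_group G t"
  unfolding weak_sequenceable_group_def
proof (intro allI impI; elim conjE)
  fix A assume A: "A \<subseteq> carrier G - {\<one>}" "finite A" "t < card A"
  \<comment> \<open>Since \<open>A\<close> has more than \<open>t\<close> elements,
    \<open>t = 3\<close> always falls under the last case, and three elements with
    \<open>t = 2\<close> are the only small set needing care. For \<open>t \<le> 1\<close> any order
    will do.\<close>
  consider "t \<le> 1" | "t = 2" "card A = 3" | "4 \<le> card A"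
    using A assms by linarith
  then show "weak_sequenceable G t A"
  proof cases
    case 1
    obtain as where "distinct as" "set as = A" using finite_distinct_list A by blast
    then have "weak_sequencing G t A as" by (rule weak_sequencingI) (use A 1 in auto)
    then show ?thesis unfolding weak_sequenceable_def by blast
  next
    case 2
    then show ?thesis using weak_sequenceable_card3 A by simp
  next
    case 3
    then obtain as where "distinct as" "set as = A" "admissible_after G \<one> \<one> as"
      using ex_admissible A by blast
    then have "weak_sequencing G t A as"
      by (intro weak_sequencingI[OF _ _ A(1) assms]
          admissible_after_consecutive admissible_after_consecutive3)
    then show ?thesis unfolding weak_sequenceable_def by blast
  qed
qed

end

theorem theorem3p2:
  fixes t n :: nat
  assumes "0 < t" and "t \<le> 3" and "0 < n"
  shows "weak_sequenceable_group (integer_mod_group n) t"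
proof -
  interpret group "integer_mod_group n" by simp
  have "comm_group (integer_mod_group n)"
    by (rule group_comm_groupI) (simp add: add.commute)
  then show ?thesis using assms comm_group.weak_sequenceable_group_le3 by blast
qed

end
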